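(* For all non-negative integers $i<j$, there exists a graph $G$ with $\zeta_i(G)\neq\zeta_j(G)$.
   Context: Graphs are finite and connected. The $k$-visibility Localization game on a finite connected graph $G$ ($k\ge 0$ an integer) with $m$ cops: the robber first chooses a vertex of $G$. Then in each round the cops choose any vertices $u_1,\dots,u_m$ (no restriction relative to earlier placements), and cop $a$ receives the probe $d_a=d(u_a,x)$ if the robber's vertex $x$ satisfies $d(u_a,x)\le k$, and $d_a=\ast$ (no information) otherwise; afterwards the robber moves to a neighboring vertex or stays in place. A candidate is a vertex the robber may occupy, consistent with the information obtained so far. The cops win if they have a strategy that, whatever the robber does, determines after finitely many rounds a unique candidate (the robber is omniscient and knows the cops' entire strategy). The $k$-visibility localization number $\zeta_k(G)$ is the least positive integer $m$ for which $m$ cops have a winning strategy. *)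

theory Defs
  imports "Graph_Theory.Graph_Theory"
begin

text \<open>
  Finite simple graphs are the symmetric loop-free finite digraphs of the locale
  \<^locale>\<open>pair_graph\<close>; each undirected edge is a pair of opposite arcs.
  \<^const>\<open>Digraph_Component.connected\<close> includes nonemptiness of the vertex set.
\<close>

definition graph_dist :: "'a pair_pre_digraph \<Rightarrow> 'a \<Rightarrow> 'a \<Rightarrow> nat" where
  "graph_dist G u v = (LEAST n. \<exists>p. pre_digraph.awalk (with_proj G) u p v \<and> length p = n)"

text \<open>A probe answer \<^const>\<open>None\<close> stands for \<open>\<ast>\<close> (no information).\<close>

definition probe :: "nat \<Rightarrow> 'a pair_pre_digraph \<Rightarrow> 'a \<Rightarrow> 'a \<Rightarrow> nat option" where
  "probe k G x u = (if graph_dist G u x \<le> k then Some (graph_dist G u x) else None)"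

definition robber_walk :: "'a pair_pre_digraph \<Rightarrow> (nat \<Rightarrow> 'a) \<Rightarrow> bool" where
  "robber_walk G x \<longleftrightarrow>
     (\<forall>t. x t \<in> pverts G) \<and> (\<forall>t. x (Suc t) = x t \<or> (x t, x (Suc t)) \<in> parcs G)"

text \<open>
  A strategy maps the answers of all earlier rounds (one list per round, one entry per cop)
  to the next placement. The earlier placements need not be passed along, since the
  strategy itself determines them from the earlier answers.
\<close>

type_synonym 'a strategy = "nat option list list \<Rightarrow> 'a list"

definition strategy_for :: "'a pair_pre_digraph \<Rightarrow> nat \<Rightarrow> 'a strategy \<Rightarrow> bool" where
  "strategy_for G m \<sigma> \<longleftrightarrow> (\<forall>h. length (\<sigma> h) = m \<and> set (\<sigma> h) \<subseteq> pverts G)"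

text \<open>The answers of the first \<open>n\<close> rounds, i.e. of rounds \<open>0, \<dots>, n - 1\<close>.\<close>

primrec answers ::
  "nat \<Rightarrow> 'a pair_pre_digraph \<Rightarrow> 'a strategy \<Rightarrow> (nat \<Rightarrow> 'a) \<Rightarrow> nat \<Rightarrow> nat option list list" where
  "answers k G \<sigma> x 0 = []"
| "answers k G \<sigma> x (Suc n) =
     answers k G \<sigma> x n @ [map (probe k G (x n)) (\<sigma> (answers k G \<sigma> x n))]"

text \<open>The candidates right after the probe of round \<open>t\<close>, before the robber's next move.\<close>

definition candidates ::
  "nat \<Rightarrow> 'a pair_pre_digraph \<Rightarrow> 'a strategy \<Rightarrow> (nat \<Rightarrow> 'a) \<Rightarrow> nat \<Rightarrow> 'a set" where
  "candidates k G \<sigma> x t =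
     {y t |y. robber_walk G y \<and> answers k G \<sigma> y (Suc t) = answers k G \<sigma> x (Suc t)}"

text \<open>
  Quantifying over all robber walks after the strategy is fixed accounts for the omniscient
  robber. The number of rounds may depend on the robber's walk.
\<close>

definition cops_win :: "nat \<Rightarrow> 'a pair_pre_digraph \<Rightarrow> nat \<Rightarrow> bool" where
  "cops_win k G m \<longleftrightarrow>
     (\<exists>\<sigma>. strategy_for G m \<sigma> \<and>
       (\<forall>x. robber_walk G x \<longrightarrow> (\<exists>t v. candidates k G \<sigma> x t = {v})))"

definition loc_number :: "nat \<Rightarrow> 'a pair_pre_digraph \<Rightarrow> nat" where
  "loc_number k G = (LEAST m. 0 < m \<and> cops_win k G m)"

lemma graph_dist_eq_mu:
  assumes "pair_wf_digraph G" and "u \<rightarrow>\<^sup>*\<^bsub>with_proj G\<^esub> v"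
  shows "wf_digraph.\<mu> (with_proj G) (\<lambda>_. 1) u v = ereal (real (graph_dist G u v))"
proof -
  interpret pair_wf_digraph G by fact
  have cost: "awalk_cost (\<lambda>_. 1) p = real (length p)" for p :: "('a \<times> 'a) list"
    by (induction p) auto
  have ex: "\<exists>n p. awalk u p v \<and> length p = n"
    using assms(2) reachable_awalk by blast
  obtain p where p: "awalk u p v" "length p = graph_dist G u v"
    using LeastI_ex[OF ex] unfolding graph_dist_def by blast
  have le: "graph_dist G u v \<le> length q" if "awalk u q v" for q
    unfolding graph_dist_def using that by (intro Least_le) blast
  show ?thesis
    unfolding \<mu>_def
  proof (rule antisym)
    show "(INF p\<in>{p. awalk u p v}. ereal (awalk_cost (\<lambda>_. 1) p)) \<le> ereal (real (graph_dist G u v))"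
      using p by (intro INF_lower2[of p]) (auto simp: cost)
    show "ereal (real (graph_dist G u v)) \<le> (INF p\<in>{p. awalk u p v}. ereal (awalk_cost (\<lambda>_. 1) p))"
      using le by (intro INF_greatest) (auto simp: cost)
  qed
qed

lemma graph_dist_eq_0_iff:
  assumes "pair_graph G" "Digraph_Component.connected (with_proj G)"
    and "u \<in> pverts G" "v \<in> pverts G"
  shows "graph_dist G u v = 0 \<longleftrightarrow> u = v"
proof -
  interpret pair_graph G by fact
  have "u \<rightarrow>\<^sup>*\<^bsub>with_proj G\<^esub> v"
    using symmetric_connected_imp_strongly_connected[OF sym_arcs assms(2)] assms(3,4)
    by (auto simp: strongly_connected_def)
  then have ex: "\<exists>n p. awalk u p v \<and> length p = n"
    using reachable_awalk by blast
  obtain p where p: "awalk u p v" "length p = graph_dist G u v"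
    using LeastI_ex[OF ex] unfolding graph_dist_def by blast
  show ?thesis
  proof
    assume "graph_dist G u v = 0"
    with p show "u = v" by (auto simp: awalk_Nil_iff)
  next
    assume "u = v"
    then have "awalk u [] v" using assms by (simp add: awalk_Nil_iff)
    then show "graph_dist G u v = 0"
      unfolding graph_dist_def by (intro Least_eq_0) auto
  qed
qed

text \<open>
  Placing a cop on every vertex wins in one round, so \<^const>\<open>loc_number\<close> is well defined.
\<close>

lemma cops_win_card:
  assumes G: "pair_graph G" "Digraph_Component.connected (with_proj G)"
  shows "cops_win k G (card (pverts G))"
proof -
  interpret pair_graph G by fact
  obtain xs where xs: "set xs = pverts G" "length xs = card (pverts G)"
    using finite_distinct_list[OF pair_finite_verts] distinct_card by metis
  have "candidates k G (\<lambda>_. xs) x 0 = {x 0}" if x: "robber_walk G x" for x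
  proof -
    have "y 0 = x 0" if y: "robber_walk G y" and
      eq: "answers k G (\<lambda>_. xs) y (Suc 0) = answers k G (\<lambda>_. xs) x (Suc 0)" for y
    proof -
      have V: "x 0 \<in> pverts G" "y 0 \<in> pverts G"
        using x y by (auto simp: robber_walk_def)
      then have "probe k G (y 0) (x 0) = probe k G (x 0) (x 0)"
        using eq xs by auto
      then have "graph_dist G (x 0) (y 0) = 0"
        using graph_dist_eq_0_iff[OF G V(1) V(1)] by (auto simp: probe_def split: if_splits)
      then show ?thesis using graph_dist_eq_0_iff[OF G V] by simp
    qed
    then show ?thesis using x by (auto simp: candidates_def)
  qed
  then show ?thesis
    unfolding cops_win_def strategy_for_def
    by (intro exI[of _ "\<lambda>_. xs"]) (use xs in auto)
qed

lemma loc_number_wins: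
  assumes G: "pair_graph G" "Digraph_Component.connected (with_proj G)"
  shows "0 < loc_number k G \<and> cops_win k G (loc_number k G)"
proof -
  interpret pair_graph G by fact
  have "pverts G \<noteq> {}"
    using G(2) by (auto simp: connected_def strongly_connected_def)
  then have "0 < card (pverts G)" by (simp add: card_gt_0_iff)
  then have "0 < card (pverts G) \<and> cops_win k G (card (pverts G))"
    using cops_win_card[OF G] by simp
  then show ?thesis
    unfolding loc_number_def by (rule LeastI)
qed

end

theory Submission
  imports Defs
begin

text \<open>
  With three cops, a long sight gives more than a short one when vertices that are close to a
  clique single out only one clique vertex each, while vertices at distance \<open>i + 1\<close> single out
  arbitrary subsets. Attach to each vertex \<open>s \<in> {1..7}\<close> of a clique a path with \<open>i\<close> edges, and
  join its far end to the hubs \<open>b \<in> {0, 1, 2}\<close> such that \<open>s\<close> has binary digit \<open>b\<close>.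
  Under \<open>j\<close>-visibility with \<open>j > i\<close>, probing the three hubs identifies every vertex: the closest
  hubs are those given by the binary digits of \<open>s\<close>, and their distance gives the position on the
  path. Under \<open>i\<close>-visibility, hubs see nothing in the clique, and a vertex on the path of \<open>s\<close> is
  equally far from all clique vertices other than \<open>s\<close>. So three probes never separate all
  clique vertices, and a robber who stays in the clique is never located.
\<close>

section \<open>Distances\<close>

lemma awalk_imp_graph_dist_le:
  assumes "pre_digraph.awalk (with_proj G) u p v"
  shows "graph_dist G u v \<le> length p"
  unfolding graph_dist_def by (rule Least_le) (use assms in blast)

lemma relpow_imp_awalk:
  assumes "pair_wf_digraph G" and "(u, v) \<in> parcs G ^^ n" and "u \<in> pverts G"
  shows "\<exists>p. pre_digraph.awalk (with_proj G) u p v \<and> length p = n"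
proof -
  interpret pair_wf_digraph G by fact
  show ?thesis
    using assms(2,3)
  proof (induction n arbitrary: u)
    case 0
    then show ?case by (auto simp: awalk_Nil_iff)
  next
    case (Suc n)
    obtain w where w: "(u, w) \<in> parcs G" "(w, v) \<in> parcs G ^^ n"
      using relpow_Suc_E2[OF Suc.prems(1)] by metis
    moreover obtain p where "awalk w p v" "length p = n"
      using Suc.IH[OF w(2)] w(1) in_arcsD2 by blast
    ultimately show ?case
      by (intro exI[of _ "(u, w) # p"]) (auto simp: awalk_Cons_iff)
  qed
qed

lemma relpow_imp_graph_dist_le:
  assumes "pair_wf_digraph G" and "(u, v) \<in> parcs G ^^ n" and "u \<in> pverts G"
  shows "graph_dist G u v \<le> n"
  using relpow_imp_awalk[OF assms] awalk_imp_graph_dist_le[of G u _ v] by metis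

text \<open>Source of all lower bounds on distances: a potential that varies by at most one per arc
  varies by at most the length of a shortest walk. The one-sided hypothesis covers both directions
  because every arc has its opposite.\<close>

lemma graph_dist_lipschitz:
  fixes f :: "'a \<Rightarrow> nat"
  assumes G: "pair_graph G" "Digraph_Component.connected (with_proj G)"
    and "u \<in> pverts G" "v \<in> pverts G"
    and f: "\<And>x y. (x, y) \<in> parcs G \<Longrightarrow> f x \<le> f y + 1"
  shows "f u \<le> f v + graph_dist G u v" "f v \<le> f u + graph_dist G u v"
proof -
  interpret pair_graph G by fact
  have "u \<rightarrow>\<^sup>*\<^bsub>with_proj G\<^esub> v"
    using symmetric_connected_imp_strongly_connected[OF sym_arcs G(2)] assms(3,4)
    by (auto simp: strongly_connected_def)
  then have "\<exists>n p. awalk u p v \<and> length p = n"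
    using reachable_awalk by blast
  from LeastI_ex[OF this] obtain p where p: "awalk u p v" "length p = graph_dist G u v"
    unfolding graph_dist_def by blast
  have "f u \<le> f v + length p \<and> f v \<le> f u + length p"
    using p(1)
  proof (induction p arbitrary: u)
    case Nil
    then show ?case by (simp add: awalk_Nil_iff)
  next
    case (Cons e p)
    then have "f (snd e) \<le> f v + length p \<and> f v \<le> f (snd e) + length p"
      and e: "(u, snd e) \<in> parcs G"
      by (auto simp: awalk_Cons_iff)
    moreover have "f u \<le> f (snd e) + 1" "f (snd e) \<le> f u + 1"
      using f e arcs_symmetric by blast+
    ultimately show ?case by simp
  qed
  with p(2) show "f u \<le> f v + graph_dist G u v" "f v \<le> f u + graph_dist G u v"
    by simp_all
qed

section \<open>Winning and losing criteria\<close>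

lemma cops_win_if_resolving:
  assumes "length us = m" "set us \<subseteq> pverts G"
    and inj: "inj_on (\<lambda>x. map (probe k G x) us) (pverts G)"
  shows "cops_win k G m"
proof -
  have "candidates k G (\<lambda>_. us) x 0 = {x 0}" if x: "robber_walk G x" for x
  proof -
    have "y 0 = x 0" if y: "robber_walk G y" and
      eq: "answers k G (\<lambda>_. us) y (Suc 0) = answers k G (\<lambda>_. us) x (Suc 0)" for y
      using inj
    proof (rule inj_onD)
      show "map (probe k G (y 0)) us = map (probe k G (x 0)) us"
        using eq by simp
    qed (use x y in \<open>auto simp: robber_walk_def\<close>)
    then show ?thesis using x by (auto simp: candidates_def)
  qed
  then show ?thesis
    unfolding cops_win_def strategy_for_def
    by (intro exI[of _ "\<lambda>_. us"]) (use assms(1,2) in auto)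
qed

text \<open>Adversary argument: each placement leaves two vertices of \<open>W\<close> with equal
  answers, and within the clique the robber can reach either of them from anywhere in
  \<open>W\<close> in one move.\<close>

lemma not_cops_win_if_unresolved_clique:
  assumes W: "W \<subseteq> pverts G"
    and clique: "\<And>a b. a \<in> W \<Longrightarrow> b \<in> W \<Longrightarrow> a \<noteq> b \<Longrightarrow> (a, b) \<in> parcs G"
    and unresolved: "\<And>us. length us = m \<Longrightarrow> set us \<subseteq> pverts G \<Longrightarrow>
      \<exists>a\<in>W. \<exists>b\<in>W. a \<noteq> b \<and> map (probe k G a) us = map (probe k G b) us"
  shows "\<not> cops_win k G m"
proof
  assume "cops_win k G m"
  then obtain \<sigma> where \<sigma>: "strategy_for G m \<sigma>"
    and win: "\<And>x. robber_walk G x \<Longrightarrow> \<exists>t v. candidates k G \<sigma> x t = {v}"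
    unfolding cops_win_def by blast
  have "\<exists>a b. a \<in> W \<and> b \<in> W \<and> a \<noteq> b \<and> map (probe k G a) (\<sigma> h) = map (probe k G b) (\<sigma> h)" for h
    using unresolved[of "\<sigma> h"] \<sigma> by (auto simp: strategy_for_def)
  then obtain a b where ab: "\<And>h. a h \<in> W" "\<And>h. b h \<in> W" "\<And>h. a h \<noteq> b h"
    "\<And>h. map (probe k G (a h)) (\<sigma> h) = map (probe k G (b h)) (\<sigma> h)"
    by metis
  \<comment> \<open>The unresolved pair depends on the history, so the history is built recursively,
    answering each time as if the robber were on \<open>a\<close>. Choosing \<open>b\<close> in any
    round gives the same answers.\<close>
  define h where "h = rec_nat [] (\<lambda>_ h. h @ [map (probe k G (a h)) (\<sigma> h)])"
  have h: "h 0 = []" "h (Suc n) = h n @ [map (probe k G (a (h n))) (\<sigma> (h n))]" for n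
    by (simp_all add: h_def)
  have walk: "robber_walk G y \<and> answers k G \<sigma> y n = h n"
    if y: "\<And>n. y n = a (h n) \<or> y n = b (h n)" for y n
  proof
    have "y n \<in> W" for n
      using y[of n] ab by auto
    then show "robber_walk G y"
      unfolding robber_walk_def using W clique by (metis subsetD)
    show "answers k G \<sigma> y n = h n"
    proof (induction n)
      case (Suc n)
      moreover have "map (probe k G (y n)) (\<sigma> (h n)) = map (probe k G (a (h n))) (\<sigma> (h n))"
        using y[of n] ab(4)[of "h n"] by metis
      ultimately show ?case by (simp only: answers.simps h)
    qed (simp add: h)
  qed
  define x where "x = (\<lambda>n. a (h n))"
  have x: "robber_walk G x" "\<And>n. answers k G \<sigma> x n = h n"
    using walk[of x] by (simp_all add: x_def)
  obtain t v where tv: "candidates k G \<sigma> x t = {v}"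
    using win x(1) by blast
  \<comment> \<open>Deviating only in the supposed deciding round yields a second candidate.\<close>
  define y where "y = x(t := b (h t))"
  have y: "robber_walk G y" "\<And>n. answers k G \<sigma> y n = h n"
    using walk[of y] by (simp_all add: y_def x_def)
  have "z t \<in> candidates k G \<sigma> x t" if "robber_walk G z" "\<And>n. answers k G \<sigma> z n = h n" for z
    unfolding candidates_def
    by (intro CollectI exI[of _ z]) (simp only: that x(2) simp_thms)
  then have "x t = v" "y t = v"
    using x y tv by blast+
  then show False
    using ab(3)[of "h t"] by (simp add: x_def y_def)
qed

section \<open>The hub graph\<close>

text \<open>
  For \<open>s \<in> {1..7}\<close> and \<open>l \<le> i\<close>, the vertex \<open>8 * l + s\<close> is at distance \<open>l\<close> from the clique vertex
  \<open>s\<close> on the path attached to \<open>s\<close>. The hubs are \<open>0\<close>, \<open>8\<close> and \<open>16\<close>.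
\<close>

definition hub_arc :: "nat \<Rightarrow> nat \<Rightarrow> nat \<Rightarrow> bool" where
  "hub_arc i x y \<longleftrightarrow>
     x mod 8 \<noteq> 0 \<and> y mod 8 \<noteq> 0 \<and> x div 8 = 0 \<and> y div 8 = 0 \<and> x \<noteq> y \<or>
     x mod 8 \<noteq> 0 \<and> y mod 8 = x mod 8 \<and> y div 8 = Suc (x div 8) \<and> y div 8 \<le> i \<or>
     x mod 8 \<noteq> 0 \<and> y mod 8 = 0 \<and> x div 8 = i \<and> y div 8 < 3 \<and> bit (x mod 8) (y div 8)"

definition hub_graph :: "nat \<Rightarrow> nat pair_pre_digraph" where
  "hub_graph i =
     \<lparr>pverts = {x. x mod 8 \<noteq> 0 \<and> x div 8 \<le> i} \<union> {x. x mod 8 = 0 \<and> x div 8 < 3},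
      parcs = {(x, y). hub_arc i x y \<or> hub_arc i y x}\<rparr>"

lemma pverts_hub_graph:
  "x \<in> pverts (hub_graph i) \<longleftrightarrow> (if x mod 8 = 0 then x div 8 < 3 else x div 8 \<le> i)"
  by (simp add: hub_graph_def)

lemma parcs_hub_graph: "(x, y) \<in> parcs (hub_graph i) \<longleftrightarrow> hub_arc i x y \<or> hub_arc i y x"
  by (simp add: hub_graph_def)

lemma pair_graph_hub_graph: "pair_graph (hub_graph i)"
proof -
  let ?G = "hub_graph i"
  have "x < 8 * i + 24" if "x \<in> pverts ?G" for x
    using that by (auto simp: pverts_hub_graph split: if_splits)
  then have "pverts ?G \<subseteq> {..<8 * i + 24}"
    by blast
  then have fin: "finite (pverts ?G)"
    using finite_subset by blast
  have wf: "x \<in> pverts ?G \<and> y \<in> pverts ?G \<and> x \<noteq> y" if "(x, y) \<in> parcs ?G" for x y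
    using that by (auto simp: parcs_hub_graph pverts_hub_graph hub_arc_def)
  then have "parcs ?G \<subseteq> pverts ?G \<times> pverts ?G"
    by auto
  then have "finite (parcs ?G)"
    using fin finite_subset finite_cartesian_product by metis
  moreover have "symmetric (with_proj ?G)"
    by (auto simp: symmetric_def arcs_ends_def arc_to_ends_def parcs_hub_graph intro!: symI)
  ultimately show ?thesis
    using fin wf by unfold_locales auto
qed

interpretation hub: pair_graph "hub_graph i" for i
  by (rule pair_graph_hub_graph)

section \<open>Walks and connectedness in the hub graph\<close>

lemma path_relpow:
  assumes "s \<in> {1..7}" and "l + n \<le> i"
  shows "(8 * (l + n) + s, 8 * l + s) \<in> parcs (hub_graph i) ^^ n"
  using assms(2)
proof (induction n)
  case (Suc n)
  have "s < 8" "0 < s"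
    using assms(1) by simp_all
  then have div_mod: "(8 * k + s) div 8 = k" "(8 * k + s) mod 8 = s" for k
    by simp_all
  have "(8 * (l + Suc n) + s, 8 * (l + n) + s) \<in> parcs (hub_graph i)"
    using Suc.prems \<open>0 < s\<close> unfolding parcs_hub_graph hub_arc_def div_mod by simp
  moreover have "(8 * (l + n) + s, 8 * l + s) \<in> parcs (hub_graph i) ^^ n"
    using Suc by simp
  ultimately show ?case by (rule relpow_Suc_I2)
qed simp

lemma path_relpow_clique:
  assumes "x mod 8 \<noteq> 0" "x div 8 \<le> i"
  shows "(x, x mod 8) \<in> parcs (hub_graph i) ^^ (x div 8)"
proof -
  have "x mod 8 < 8" by simp
  then have "x mod 8 \<in> {1..7}" using assms(1) by simp
  from path_relpow[of _ 0 "x div 8" i, OF this] assms(2) show ?thesis by simp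
qed

lemma hub_relpow:
  assumes "x mod 8 \<noteq> 0" "x div 8 \<le> i" "b < 3" "bit (x mod 8) b"
  shows "(8 * b, x) \<in> parcs (hub_graph i) ^^ Suc (i - x div 8)"
proof (rule relpow_Suc_I2)
  have "x mod 8 < 8" by simp
  then have s: "x mod 8 \<in> {1..7}" using assms(1) by simp
  show "(8 * b, 8 * i + x mod 8) \<in> parcs (hub_graph i)"
    using assms by (simp add: parcs_hub_graph hub_arc_def)
  show "(8 * i + x mod 8, x) \<in> parcs (hub_graph i) ^^ (i - x div 8)"
    using path_relpow[OF s, of "x div 8" "i - x div 8" i] assms(2) by simp
qed

lemma ex_bit_less_3:
  fixes s :: nat
  assumes "s < 8" "s \<noteq> 0"
  shows "\<exists>b<3. bit s b"
proof -
  have "take_bit 3 s = s"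
    using assms(1) by (simp add: take_bit_nat_eq_self)
  moreover obtain b where "bit s b"
    using assms(2) bit_eq_iff[of s 0] by auto
  ultimately show ?thesis
    by (metis bit_take_bit_iff)
qed

lemma eq_if_bits_less_3:
  fixes s t :: nat
  assumes "s < 8" "t < 8" "\<And>b. b < 3 \<Longrightarrow> bit s b = bit t b"
  shows "s = t"
proof -
  have "take_bit 3 s = s" "take_bit 3 t = t"
    using assms(1,2) by (simp_all add: take_bit_nat_eq_self)
  then show ?thesis
    by (metis assms(3) bit_eq_iff bit_take_bit_iff)
qed

lemma connected_hub_graph: "Digraph_Component.connected (with_proj (hub_graph i))"
proof -
  let ?G = "with_proj (hub_graph i)"
  have relpow: "x \<rightarrow>\<^sup>*\<^bsub>?G\<^esub> y" if "(x, y) \<in> parcs (hub_graph i) ^^ n" "x \<in> pverts (hub_graph i)" for x y n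
    using relpow_imp_awalk[OF _ that] hub.pair_wf_digraph_axioms hub.reachable_awalk by blast
  have path: "x \<rightarrow>\<^sup>*\<^bsub>?G\<^esub> 1" if "x mod 8 \<noteq> 0" "x div 8 \<le> i" for x
  proof -
    have "x \<rightarrow>\<^sup>*\<^bsub>?G\<^esub> (x mod 8)"
      using relpow[OF path_relpow_clique[OF that]] that by (simp add: pverts_hub_graph)
    moreover have "(x mod 8) \<rightarrow>\<^sup>*\<^bsub>?G\<^esub> 1"
    proof (cases "x mod 8 = 1")
      case False
      then have "(x mod 8, 1) \<in> parcs (hub_graph i)"
        using that by (simp add: parcs_hub_graph hub_arc_def)
      then show ?thesis using hub.reachable_adjI[of "x mod 8" i 1] by simp
    qed (simp add: pverts_hub_graph)
    ultimately show ?thesis by (rule hub.reachable_trans)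
  qed
  have one: "x \<rightarrow>\<^sup>*\<^bsub>?G\<^esub> 1" if x: "x \<in> pverts (hub_graph i)" for x
  proof (cases "x mod 8 = 0")
    case True
    define b where "b = x div 8"
    then have b: "x = 8 * b" "b < 3"
      using True x by (auto simp: pverts_hub_graph)
    \<comment> \<open>All three binary digits of 7 are set, so every hub is joined to the path of
      7.\<close>
    define y :: nat where "y = 7"
    have "bit y b"
      using b(2) by (auto simp: y_def less_Suc_eq numeral_3_eq_3 bit_iff_odd)
    then have "x \<rightarrow>\<^sup>*\<^bsub>?G\<^esub> y"
      using relpow[OF hub_relpow[of y i b]] b x by (simp add: y_def)
    also have "y \<rightarrow>\<^sup>*\<^bsub>?G\<^esub> 1"
      by (rule path) (simp_all add: y_def)
    finally show ?thesis .
  qed (use path x in \<open>simp add: pverts_hub_graph\<close>)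
  have "x \<rightarrow>\<^sup>*\<^bsub>?G\<^esub> y" if "x \<in> pverts (hub_graph i)" "y \<in> pverts (hub_graph i)" for x y
    using one[OF that(1)] symmetric_reachable[OF hub.sym_arcs one[OF that(2)]]
    by (rule hub.reachable_trans)
  moreover have "1 \<in> pverts (hub_graph i)"
    by (simp add: pverts_hub_graph)
  ultimately show ?thesis
    unfolding connected_def strongly_connected_def hub.reachable_mk_symmetric_eq[OF hub.sym_arcs]
    by auto
qed

section \<open>Distances from hubs and from path vertices\<close>

lemmas hub_lipschitz = graph_dist_lipschitz[OF pair_graph_hub_graph connected_hub_graph]

text \<open>A lower bound for the distance to hub \<open>b\<close>. It is exact on the paths joined
  to \<open>b\<close>; a missing digit costs at least one more step.\<close>

definition hub_potential :: "nat \<Rightarrow> nat \<Rightarrow> nat \<Rightarrow> nat" where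
  "hub_potential i b x =
     (if x mod 8 = 0 then if x div 8 = b then 0 else 1
      else if bit (x mod 8) b then i + 1 - x div 8 else i + 2 - x div 8)"

lemma hub_potential_le_dist:
  assumes "x \<in> pverts (hub_graph i)" "b < 3"
  shows "hub_potential i b x \<le> graph_dist (hub_graph i) (8 * b) x"
proof -
  have arc: "hub_potential i b x \<le> hub_potential i b y + 1 \<and> hub_potential i b y \<le> hub_potential i b x + 1"
    if "hub_arc i x y" for x y
    using that unfolding hub_arc_def hub_potential_def
    by (elim disjE conjE) (auto simp: Suc_diff_le)
  have "hub_potential i b y \<le> hub_potential i b z + 1" if "(y, z) \<in> parcs (hub_graph i)" for y z
    using that arc[of y z] arc[of z y] by (auto simp: parcs_hub_graph)
  from hub_lipschitz(2)[of "8 * b" i x, OF _ assms(1) this]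
  have "hub_potential i b x \<le> hub_potential i b (8 * b) + graph_dist (hub_graph i) (8 * b) x"
    using assms(2) by (simp add: pverts_hub_graph)
  then show ?thesis
    by (simp add: hub_potential_def)
qed

lemma hub_dist_if_bit:
  assumes "x mod 8 \<noteq> 0" "x div 8 \<le> i" "b < 3" "bit (x mod 8) b"
  shows "graph_dist (hub_graph i) (8 * b) x = i + 1 - x div 8"
proof (rule antisym)
  show "graph_dist (hub_graph i) (8 * b) x \<le> i + 1 - x div 8"
    using relpow_imp_graph_dist_le[OF hub.pair_wf_digraph_axioms hub_relpow[OF assms]] assms
    by (simp add: pverts_hub_graph)
  show "i + 1 - x div 8 \<le> graph_dist (hub_graph i) (8 * b) x"
    using hub_potential_le_dist[of x i b] assms by (simp add: pverts_hub_graph hub_potential_def)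
qed

text \<open>The shortest route descends to the clique and crosses one edge. A detour through a hub
  cannot help, since hubs are at distance at least \<open>i + 1\<close> from the clique. The value
  does not depend on \<open>w\<close>.\<close>

lemma path_clique_dist:
  assumes x: "x mod 8 \<noteq> 0" "x div 8 \<le> i" and w: "w \<in> {1..7}" "w \<noteq> x mod 8"
  shows "graph_dist (hub_graph i) x w = Suc (x div 8)"
proof (rule antisym)
  have X: "x \<in> pverts (hub_graph i)" "w \<in> pverts (hub_graph i)"
    using x w by (auto simp: pverts_hub_graph)
  have "(x mod 8, w) \<in> parcs (hub_graph i)"
    using x w by (auto simp: parcs_hub_graph hub_arc_def)
  with path_relpow_clique[OF x] have "(x, w) \<in> parcs (hub_graph i) ^^ Suc (x div 8)"
    by (rule relpow_Suc_I)
  then show "graph_dist (hub_graph i) x w \<le> Suc (x div 8)"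
    using relpow_imp_graph_dist_le[OF hub.pair_wf_digraph_axioms] X by blast
  \<comment> \<open>A lower bound for the distance to \<open>w\<close>: it vanishes at
    \<open>w\<close> and equals the claimed distance at \<open>x\<close>.\<close>
  define f where "f y = (if y mod 8 = 0 then i + 1 else if y mod 8 = w then y div 8
    else y div 8 + 1)" for y
  have "f y \<le> f z + 1 \<and> f z \<le> f y + 1" if "hub_arc i y z" for y z
    using that unfolding hub_arc_def f_def by (elim disjE conjE) auto
  then have "f y \<le> f z + 1" if "(y, z) \<in> parcs (hub_graph i)" for y z
    using that by (auto simp: parcs_hub_graph)
  from hub_lipschitz(1)[of x i w f, OF X this] show "Suc (x div 8) \<le> graph_dist (hub_graph i) x w"
    using x w by (simp add: f_def)
qed

section \<open>Three probes under long and short sight\<close>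

lemma cops_win_hub_graph:
  assumes "i < j"
  shows "cops_win j (hub_graph i) 3"
proof (rule cops_win_if_resolving[of "map ((*) 8) [0..<3]"])
  let ?G = "hub_graph i"
  let ?d = "graph_dist ?G"
  have V: "8 * b \<in> pverts ?G" if "b < 3" for b
    using that by (simp add: pverts_hub_graph)
  show "set (map ((*) 8) [0..<3]) \<subseteq> pverts ?G"
    using V by auto
  have probe_eqD: "?d u y = ?d u x" if "probe j ?G x u = probe j ?G y u" "?d u x \<le> j" for u x y
    using that by (auto simp: probe_def split: if_splits)
  have hub_eq: "x = y"
    if "\<And>b. b < 3 \<Longrightarrow> probe j ?G x (8 * b) = probe j ?G y (8 * b)" "x mod 8 = 0"
      "x \<in> pverts ?G" "y \<in> pverts ?G" for x y
  proof -
    have "?d x x = 0"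
      using graph_dist_eq_0_iff[OF pair_graph_hub_graph connected_hub_graph that(3,3)] by simp
    moreover have "probe j ?G x x = probe j ?G y x"
      using that(1)[of "x div 8"] that(2,3) by (auto simp: pverts_hub_graph)
    ultimately have "?d x y = 0"
      using probe_eqD[of x x y] by (metis le0)
    then show ?thesis
      using graph_dist_eq_0_iff[OF pair_graph_hub_graph connected_hub_graph that(3,4)] by simp
  qed
  \<comment> \<open>A hub joined to the path of \<open>x\<close> sees \<open>x\<close>, at distance
    at most \<open>i + 1 \<le> j\<close>. Hence \<open>y\<close> is at the same distance.\<close>
  have potential_le: "hub_potential i b y \<le> i + 1 - x div 8"
    if "\<And>b. b < 3 \<Longrightarrow> probe j ?G x (8 * b) = probe j ?G y (8 * b)" "x mod 8 \<noteq> 0"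
      "x \<in> pverts ?G" "y \<in> pverts ?G" "b < 3" "bit (x mod 8) b" for x y b
  proof -
    have "?d (8 * b) x = i + 1 - x div 8"
      using hub_dist_if_bit that by (simp add: pverts_hub_graph)
    then have "?d (8 * b) y = i + 1 - x div 8"
      using probe_eqD[OF that(1)[OF that(5)]] assms by simp
    then show ?thesis
      using hub_potential_le_dist[OF that(4,5)] by simp
  qed
  have level_le: "x div 8 \<le> y div 8"
    if prem: "\<And>b. b < 3 \<Longrightarrow> probe j ?G x (8 * b) = probe j ?G y (8 * b)" "x mod 8 \<noteq> 0"
      "y mod 8 \<noteq> 0" "x \<in> pverts ?G" "y \<in> pverts ?G" for x y
  proof -
    obtain b where "b < 3" "bit (x mod 8) b"
      using ex_bit_less_3[of "x mod 8"] prem(2) by auto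
    from potential_le[OF prem(1,2,4,5) this] have "hub_potential i b y \<le> i + 1 - x div 8" .
    moreover have "i + 1 - y div 8 \<le> hub_potential i b y"
      using prem(3) by (simp add: hub_potential_def diff_le_mono)
    moreover have "x div 8 \<le> i" "y div 8 \<le> i"
      using prem by (auto simp: pverts_hub_graph)
    ultimately show ?thesis by linarith
  qed
  show "inj_on (\<lambda>x. map (probe j ?G x) (map ((*) 8) [0..<3])) (pverts ?G)"
  proof (rule inj_onI)
    fix x y
    assume V: "x \<in> pverts ?G" "y \<in> pverts ?G"
      and "map (probe j ?G x) (map ((*) 8) [0..<3]) = map (probe j ?G y) (map ((*) 8) [0..<3])"
    then have eq: "\<And>b. b < 3 \<Longrightarrow> probe j ?G x (8 * b) = probe j ?G y (8 * b)"
      by auto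
    show "x = y"
    proof (cases "x mod 8 = 0 \<or> y mod 8 = 0")
      case True
      then show ?thesis using hub_eq[of x y] hub_eq[of y x] V eq by metis
    next
      case False
      then have level: "x div 8 = y div 8"
        using level_le[of x y] level_le[of y x] V eq by (metis antisym)
      \<comment> \<open>At equal levels, a digit of \<open>x\<close> missing in \<open>y\<close>
        would raise the potential of \<open>y\<close> one above the bound; the converse is
        symmetric.\<close>
      have "bit (x mod 8) b = bit (y mod 8) b" if "b < 3" for b
        using potential_le[of x y b] potential_le[of y x b] V eq that level False
        by (auto simp: hub_potential_def pverts_hub_graph split: if_splits)
      then have "x mod 8 = y mod 8"
        by (intro eq_if_bits_less_3) auto
      with level show ?thesis
        by (metis div_mult_mod_eq)
    qed
  qed
qed simp

text \<open>Covering every \<open>m \<le> 3\<close> bounds the least winning number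
  directly.\<close>

lemma not_cops_win_hub_graph:
  assumes "m \<le> 3"
  shows "\<not> cops_win i (hub_graph i) m"
proof (rule not_cops_win_if_unresolved_clique[where W = "{1..7}"])
  let ?G = "hub_graph i"
  fix us
  assume us: "length us = m" "set us \<subseteq> pverts ?G"
  \<comment> \<open>The paths carrying a cop, with 0 standing for hubs. At least four clique
    vertices lie outside \<open>H\<close>.\<close>
  define H where "H = (\<lambda>u. u mod 8) ` set us"
  have "card H \<le> 3"
    using card_image_le[of "set us" "\<lambda>u. u mod 8"] card_length[of us] us(1) assms
    by (simp add: H_def)
  then have "2 \<le> card ({1..7} - H)"
    using diff_card_le_card_Diff[of H "{1..7}"] by (simp add: H_def)
  then obtain a b where ab: "a \<in> {1..7} - H" "b \<in> {1..7} - H" "a \<noteq> b"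
    using card_le_Suc0_iff_eq[of "{1..7} - H"] by force
  have "probe i ?G a u = probe i ?G b u" if u: "u \<in> set us" for u
  proof (cases "u mod 8 = 0")
    case True
    define c where "c = u div 8"
    then have c: "u = 8 * c" "c < 3"
      using True u us(2) by (auto simp: pverts_hub_graph)
    \<comment> \<open>On the clique the potential is at least \<open>i + 1\<close>, so a hub gets no
      information there.\<close>
    have "i < graph_dist ?G u w" if "w \<in> {1..7}" for w
      using hub_potential_le_dist[of w i c] c that
      by (auto simp: hub_potential_def pverts_hub_graph split: if_splits)
    then have "i < graph_dist ?G u a" "i < graph_dist ?G u b"
      using ab by blast+
    then show ?thesis by (simp add: probe_def)
  next
    case False
    then have "u div 8 \<le> i" "u mod 8 \<in> H"
      using u us(2) by (auto simp: H_def pverts_hub_graph)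
    then have "graph_dist ?G u a = graph_dist ?G u b"
      using path_clique_dist[OF False] ab by (metis DiffE)
    then show ?thesis by (simp add: probe_def)
  qed
  then show "\<exists>a\<in>{1..7}. \<exists>b\<in>{1..7}. a \<noteq> b \<and> map (probe i ?G a) us = map (probe i ?G b) us"
    using ab by (intro bexI[of _ a] bexI[of _ b]) auto
qed (auto simp: pverts_hub_graph parcs_hub_graph hub_arc_def)

theorem mainTheorem4:
  fixes i j :: nat
  assumes "i < j"
  shows "\<exists>G :: nat pair_pre_digraph.
    pair_graph G \<and> Digraph_Component.connected (with_proj G) \<and> loc_number i G \<noteq> loc_number j G"
proof -
  let ?G = "hub_graph i"
  have "loc_number j ?G \<le> 3"
    unfolding loc_number_def using cops_win_hub_graph[OF assms] by (intro Least_le) simp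
  moreover have "\<not> loc_number i ?G \<le> 3"
    using loc_number_wins[OF pair_graph_hub_graph connected_hub_graph] not_cops_win_hub_graph
    by blast
  ultimately have "loc_number i ?G \<noteq> loc_number j ?G"
    by auto
  then show ?thesis
    using pair_graph_hub_graph connected_hub_graph by blast
qed

end
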